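(* There exists a topological group automorphism $\sigma$ of the torus $\mathbb{T}^2$ such that, for the two-dimensional Lie group $G := \mathbb{T}^2 \rtimes \mathbb{Z}$ (the topological semidirect product with respect to the action of the discrete group $\mathbb{Z}$ on $\mathbb{T}^2$ given by $(k,x) \mapsto \sigma^k(x)$) and its cocompact discrete subgroup $H := \mathbb{Z}$ (identified with $\{e\} \times \mathbb{Z}$, where $e$ is the identity of $\mathbb{T}^2$), the compact two-dimensional homogeneous $G$-space $G/H$, with the natural left action of $G$, is not Rosenthal representable.
   Context: All topological spaces are assumed to be Tychonoff. For a topological group $G$, a $G$-space is a topological space $X$ with a continuous action $G \times X \to X$. For a Banach space $V$, $\mathrm{Iso}(V)$ is the topological group of linear isometries of $V$ onto itself with the strong operator topology; it acts on the dual $V^*$ by $(gu^* )(v) = u^*(g^{-1}v)$. A representation of a $G$-space $X$ on $V$ is a pair $(h,\alpha)$ where $h \colon G \to \mathrm{Iso}(V)$ is a continuous homomorphism and $\alpha \colon X \to V^*$ is a norm-bounded, weak-star continuous map that is equivariant: $\alpha(gx) = h(g)\alpha(x)$ for all $g \in G$, $x \in X$. The representation is proper if $\alpha$ is a topological embedding (with $V^*$ carrying the weak-star topology). A Banach space $V$ is called a Rosenthal space if it does not contain an isomorphic copy of $l_1$ (equivalently, every bounded sequence in $V$ has a weak-Cauchy subsequence). A $G$-space (or its action) is Rosenthal representable if it admits a proper representation on some Rosenthal Banach space $V$. *)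

theory Defs
  imports
    "HOL-Analysis.Analysis"
    "HOL-Algebra.Coset"
    "HOL-Algebra.Bij"
    "HOL-Algebra.Elementary_Groups"
begin


section \<open>Topological groups and their actions\<close>

definition tychonoff_space :: "'a topology \<Rightarrow> bool" where
  "tychonoff_space X \<longleftrightarrow> Hausdorff_space X \<and> completely_regular_space X"

definition topological_group :: "('g, 'm) monoid_scheme \<Rightarrow> 'g topology \<Rightarrow> bool" where
  "topological_group G T \<longleftrightarrow>
     group G \<and> topspace T = carrier G \<and> tychonoff_space T \<and>
     continuous_map (prod_topology T T) T (\<lambda>(x, y). x \<otimes>\<^bsub>G\<^esub> y) \<and>
     continuous_map T T (\<lambda>x. inv\<^bsub>G\<^esub> x)"

text \<open>Elements of \<^term>\<open>auto G\<close> are extensional, so that they form the group \<^term>\<open>AutoGroup G\<close>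
  and a possibly negative power of an automorphism makes sense there.\<close>

definition topological_group_automorphism ::
    "('g, 'm) monoid_scheme \<Rightarrow> 'g topology \<Rightarrow> ('g \<Rightarrow> 'g) \<Rightarrow> bool" where
  "topological_group_automorphism G T \<sigma> \<longleftrightarrow> \<sigma> \<in> auto G \<and> homeomorphic_map T T \<sigma>"

definition g_space ::
    "('g, 'm) monoid_scheme \<Rightarrow> 'g topology \<Rightarrow> 'x topology \<Rightarrow> ('g \<Rightarrow> 'x \<Rightarrow> 'x) \<Rightarrow> bool" where
  "g_space G T X act \<longleftrightarrow>
     topological_group G T \<and> tychonoff_space X \<and>
     continuous_map (prod_topology T X) X (\<lambda>(g, x). act g x) \<and>
     (\<forall>x\<in>topspace X. act \<one>\<^bsub>G\<^esub> x = x) \<and>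
     (\<forall>g\<in>carrier G. \<forall>h\<in>carrier G. \<forall>x\<in>topspace X. act (g \<otimes>\<^bsub>G\<^esub> h) x = act g (act h x))"

definition left_cosets :: "('g, 'm) monoid_scheme \<Rightarrow> 'g set \<Rightarrow> 'g set set" where
  "left_cosets G H = (\<lambda>g. g <#\<^bsub>G\<^esub> H) ` carrier G"

text \<open>The quotient topology on the set of left cosets.\<close>

definition coset_topology :: "('g, 'm) monoid_scheme \<Rightarrow> 'g topology \<Rightarrow> 'g set \<Rightarrow> 'g set topology" where
  "coset_topology G T H =
     topology (\<lambda>U. U \<subseteq> left_cosets G H \<and> openin T {g \<in> topspace T. g <#\<^bsub>G\<^esub> H \<in> U})"

lemma openin_coset_topology:
  "openin (coset_topology G T H) U \<longleftrightarrow>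
     U \<subseteq> left_cosets G H \<and> openin T {g \<in> topspace T. g <#\<^bsub>G\<^esub> H \<in> U}"
proof -
  let ?P = "\<lambda>U. U \<subseteq> left_cosets G H \<and> openin T {g \<in> topspace T. g <#\<^bsub>G\<^esub> H \<in> U}"
  have "istopology ?P"
    unfolding istopology_def
  proof (intro conjI allI impI)
    fix S S' assume "?P S" "?P S'"
    moreover have "{g \<in> topspace T. g <#\<^bsub>G\<^esub> H \<in> S \<inter> S'} =
        {g \<in> topspace T. g <#\<^bsub>G\<^esub> H \<in> S} \<inter> {g \<in> topspace T. g <#\<^bsub>G\<^esub> H \<in> S'}"
      by blast
    ultimately show "S \<inter> S' \<subseteq> left_cosets G H" "openin T {g \<in> topspace T. g <#\<^bsub>G\<^esub> H \<in> S \<inter> S'}"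
      by auto
  next
    fix K assume K: "\<forall>S\<in>K. ?P S"
    then show "\<Union>K \<subseteq> left_cosets G H" by blast
    have "{g \<in> topspace T. g <#\<^bsub>G\<^esub> H \<in> \<Union>K} = (\<Union>S\<in>K. {g \<in> topspace T. g <#\<^bsub>G\<^esub> H \<in> S})"
      by blast
    with K show "openin T {g \<in> topspace T. g <#\<^bsub>G\<^esub> H \<in> \<Union>K}"
      by auto
  qed
  then show ?thesis
    by (simp add: coset_topology_def)
qed

text \<open>Two-dimensionality of a space is expressed by its being a topological surface.\<close>

definition topological_2_manifold :: "'a topology \<Rightarrow> bool" where
  "topological_2_manifold X \<longleftrightarrow>
     Hausdorff_space X \<and> second_countable X \<and>
     (\<forall>x\<in>topspace X. \<exists>U. \<exists>W :: (real ^ 2) set.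
        openin X U \<and> x \<in> U \<and> open W \<and> subtopology X U homeomorphic_space top_of_set W)"

section \<open>The torus and its semidirect products with the integers\<close>

definition circle_group :: "complex monoid" where
  "circle_group = \<lparr>carrier = sphere 0 1, monoid.mult = (*), one = 1\<rparr>"

definition torus :: "(complex \<times> complex) monoid" where
  "torus = circle_group \<times>\<times> circle_group"

definition torus_topology :: "(complex \<times> complex) topology" where
  "torus_topology = prod_topology (top_of_set (sphere 0 1)) (top_of_set (sphere 0 1))"

definition semidirect_product ::
    "('n, 'a) monoid_scheme \<Rightarrow> ('k, 'b) monoid_scheme \<Rightarrow> ('k \<Rightarrow> 'n \<Rightarrow> 'n) \<Rightarrow> ('n \<times> 'k) monoid" where
  "semidirect_product N K \<phi> =
     \<lparr>carrier = carrier N \<times> carrier K,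
      monoid.mult = (\<lambda>(x, k) (y, l). (x \<otimes>\<^bsub>N\<^esub> \<phi> k y, k \<otimes>\<^bsub>K\<^esub> l)),
      one = (\<one>\<^bsub>N\<^esub>, \<one>\<^bsub>K\<^esub>)\<rparr>"

definition torus_semidirect ::
    "(complex \<times> complex \<Rightarrow> complex \<times> complex) \<Rightarrow> ((complex \<times> complex) \<times> int) monoid" where
  "torus_semidirect \<sigma> =
     semidirect_product torus integer_group (\<lambda>k::int. \<sigma> [^]\<^bsub>AutoGroup torus\<^esub> k)"

definition torus_semidirect_topology :: "((complex \<times> complex) \<times> int) topology" where
  "torus_semidirect_topology = prod_topology torus_topology (discrete_topology UNIV)"

definition integer_subgroup :: "((complex \<times> complex) \<times> int) set" where
  "integer_subgroup = {\<one>\<^bsub>torus\<^esub>} \<times> UNIV"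

section \<open>Representations on Banach spaces\<close>

text \<open>On both \<open>V \<Rightarrow>\<^sub>L V\<close> and the dual \<open>V \<Rightarrow>\<^sub>L real\<close>, \<^const>\<open>strong_operator_topology\<close> is the
  topology of pointwise convergence on \<open>V\<close>; on the dual this is the weak-star topology.\<close>

definition isometry_group :: "('v::real_normed_vector \<Rightarrow>\<^sub>L 'v) monoid" where
  "isometry_group =
     \<lparr>carrier = {f. (\<forall>v. norm (blinfun_apply f v) = norm v) \<and> surj (blinfun_apply f)},
      monoid.mult = (o\<^sub>L), one = id_blinfun\<rparr>"

definition isometry_group_topology :: "('v::real_normed_vector \<Rightarrow>\<^sub>L 'v) topology" where
  "isometry_group_topology = subtopology strong_operator_topology (carrier isometry_group)"

definition weak_star_topology :: "('v::real_normed_vector \<Rightarrow>\<^sub>L real) topology" where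
  "weak_star_topology = strong_operator_topology"

definition dual_action ::
    "('v::real_normed_vector \<Rightarrow>\<^sub>L 'v) \<Rightarrow> ('v \<Rightarrow>\<^sub>L real) \<Rightarrow> ('v \<Rightarrow>\<^sub>L real)" where
  "dual_action f u = u o\<^sub>L inv\<^bsub>isometry_group\<^esub> f"

definition is_representation ::
    "('g, 'm) monoid_scheme \<Rightarrow> 'g topology \<Rightarrow> 'x topology \<Rightarrow> ('g \<Rightarrow> 'x \<Rightarrow> 'x) \<Rightarrow>
     ('g \<Rightarrow> ('v::banach \<Rightarrow>\<^sub>L 'v)) \<Rightarrow> ('x \<Rightarrow> ('v \<Rightarrow>\<^sub>L real)) \<Rightarrow> bool" where
  "is_representation G T X act h \<alpha> \<longleftrightarrow>
     h \<in> hom G isometry_group \<and> continuous_map T isometry_group_topology h \<and>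
     bounded (\<alpha> ` topspace X) \<and> continuous_map X weak_star_topology \<alpha> \<and>
     (\<forall>g\<in>carrier G. \<forall>x\<in>topspace X. \<alpha> (act g x) = dual_action (h g) (\<alpha> x))"

definition is_proper_representation ::
    "('g, 'm) monoid_scheme \<Rightarrow> 'g topology \<Rightarrow> 'x topology \<Rightarrow> ('g \<Rightarrow> 'x \<Rightarrow> 'x) \<Rightarrow>
     ('g \<Rightarrow> ('v::banach \<Rightarrow>\<^sub>L 'v)) \<Rightarrow> ('x \<Rightarrow> ('v \<Rightarrow>\<^sub>L real)) \<Rightarrow> bool" where
  "is_proper_representation G T X act h \<alpha> \<longleftrightarrow>
     is_representation G T X act h \<alpha> \<and> embedding_map X weak_star_topology \<alpha>"

definition l1_carrier :: "(nat \<Rightarrow> real) set" where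
  "l1_carrier = {a. summable (\<lambda>n. \<bar>a n\<bar>)}"

definition l1_norm :: "(nat \<Rightarrow> real) \<Rightarrow> real" where
  "l1_norm a = (\<Sum>n. \<bar>a n\<bar>)"

text \<open>A linear map with the two-sided estimate below is exactly a linear homeomorphism of \<open>l\<^sub>1\<close>
  onto its image.\<close>

definition contains_l1 :: "'v::real_normed_vector itself \<Rightarrow> bool" where
  "contains_l1 _ \<longleftrightarrow>
     (\<exists>(J :: (nat \<Rightarrow> real) \<Rightarrow> 'v) c C. 0 < c \<and>
        (\<forall>a\<in>l1_carrier. \<forall>b\<in>l1_carrier. J (\<lambda>n. a n + b n) = J a + J b) \<and>
        (\<forall>a\<in>l1_carrier. \<forall>r. J (\<lambda>n. r * a n) = r *\<^sub>R J a) \<and>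
        (\<forall>a\<in>l1_carrier. c * l1_norm a \<le> norm (J a) \<and> norm (J a) \<le> C * l1_norm a))"

definition rosenthal_space :: "'v::banach itself \<Rightarrow> bool" where
  "rosenthal_space V \<longleftrightarrow> \<not> contains_l1 V"

text \<open>A Banach space is a type of class \<^class>\<open>banach\<close>. A \<open>G\<close>-space is Rosenthal representable
  if the following holds for some type \<open>'v\<close>. A formula cannot quantify over types, so
  non-representability is the negation of this predicate for a type variable \<open>'v\<close>.
  Pitfall: such a type variable is quantified outside the whole theorem, so an object whose
  existence is asserted together with non-representability must be pinned down by a condition
  not involving \<open>'v\<close>; otherwise it could depend on the Banach space.\<close>

definition rosenthal_representable_on ::
    "'v::banach itself \<Rightarrow> ('g, 'm) monoid_scheme \<Rightarrow> 'g topology \<Rightarrow> 'x topology \<Rightarrow>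
     ('g \<Rightarrow> 'x \<Rightarrow> 'x) \<Rightarrow> bool" where
  "rosenthal_representable_on V G T X act \<longleftrightarrow>
     rosenthal_space V \<and>
     (\<exists>(h :: 'g \<Rightarrow> ('v \<Rightarrow>\<^sub>L 'v)) \<alpha>. is_proper_representation G T X act h \<alpha>)"

end

theory Submission
  imports Defs
begin

text \<open>The automorphism is the shear \<open>\<sigma> (z, w) = (z, zw)\<close>, and \<open>G/H\<close> is the torus, on which
  \<open>\<int>\<close> acts by \<open>\<sigma>\<^sup>k (z, w) = (z, z\<^sup>k w)\<close>. Let \<open>(h, \<alpha>)\<close> be a proper representation on \<open>V\<close>. Since
  \<open>\<alpha>\<close> is injective, some \<open>v \<in> V\<close> separates \<open>\<alpha> (1, 1)\<close> from \<open>\<alpha> (1, -1)\<close>; put \<open>f x = \<alpha> x v\<close>. By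
  equivariance \<open>f (z, z\<^sup>k)\<close> is the value of \<open>\<alpha> (z, 1)\<close> at \<open>v\<^sub>k = h(k)\<inverse> v\<close>, and \<open>v\<^sub>k\<close> has the norm of
  \<open>v\<close>. If \<open>k\<close> runs through the powers of a large even number, then \<open>z\<close> near \<open>1\<close> can be chosen such
  that finitely many of the \<open>z\<^sup>k\<close> are near \<open>1\<close> or near \<open>-1\<close> in any prescribed pattern. So the
  corresponding \<open>v\<^sub>k\<close> are independent functions on a bounded subset of the dual, and they span a
  copy of \<open>l\<^sub>1\<close> in \<open>V\<close>; Rosenthal's dichotomy is not needed.\<close>

section \<open>Independent sequences span \<open>l\<^sub>1\<close>\<close>

text \<open>Take one functional for the set of indices with nonnegative coefficient and one for its
  complement. Their difference, applied to a finite sum, gains at least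
  \<open>(b - a) * \<bar>c n\<bar>\<close> from every term and has norm at most twice the bound
  \<open>M\<close>. The resulting constants do not depend on \<open>K\<close>, so the lower estimate
  passes to infinite series.\<close>

lemma independent_imp_contains_l1:
  fixes v :: "nat \<Rightarrow> 'v::banach" and a b B M :: real
  assumes v: "\<And>n. norm (v n) \<le> B" and ab: "a < b"
    and indep: "\<And>A K. \<exists>u :: 'v \<Rightarrow>\<^sub>L real. norm u \<le> M \<and>
      (\<forall>n<K. (n \<in> A \<longrightarrow> b \<le> blinfun_apply u (v n)) \<and> (n \<notin> A \<longrightarrow> blinfun_apply u (v n) \<le> a))"
  shows "contains_l1 TYPE('v)"
proof -
  \<comment> \<open>Outside \<open>l1_carrier\<close> the series may diverge;
    \<open>contains_l1\<close> constrains \<open>J\<close> on \<open>l1_carrier\<close>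
    only.\<close>
  define J where "J c = (\<Sum>n. c n *\<^sub>R v n)" for c :: "nat \<Rightarrow> real"
  have sums: "summable (\<lambda>n. norm (c n *\<^sub>R v n))" if "c \<in> l1_carrier" for c
  proof (rule summable_comparison_test)
    show "\<exists>N. \<forall>n\<ge>N. norm (norm (c n *\<^sub>R v n)) \<le> \<bar>c n\<bar> * B"
      using v by (auto intro!: mult_left_mono)
    show "summable (\<lambda>n. \<bar>c n\<bar> * B)"
      using that by (auto simp: l1_carrier_def intro: summable_mult2)
  qed
  note summ = summable_norm_cancel[OF sums]
  \<comment> \<open>A strictly positive bound, because \<open>2 * M'\<close> becomes the denominator
    of the lower constant.\<close>
  define M' where "M' = max M 1"
  have M': "M' > 0" "M \<le> M'" by (auto simp: M'_def)
  have finite_bound: "(b - a) * (\<Sum>n<K. \<bar>c n\<bar>) \<le> 2 * M' * norm (\<Sum>n<K. c n *\<^sub>R v n)" for c K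
  proof -
    define x where "x = (\<Sum>n<K. c n *\<^sub>R v n)"
    let ?P = "{n. c n \<ge> 0}"
    obtain u u' :: "'v \<Rightarrow>\<^sub>L real" where u: "norm u \<le> M" "norm u' \<le> M"
      and up: "\<And>n. n < K \<Longrightarrow> n \<in> ?P \<Longrightarrow> b \<le> blinfun_apply u (v n)" "\<And>n. n < K \<Longrightarrow> n \<notin> ?P \<Longrightarrow> blinfun_apply u (v n) \<le> a"
        "\<And>n. n < K \<Longrightarrow> n \<in> - ?P \<Longrightarrow> b \<le> blinfun_apply u' (v n)" "\<And>n. n < K \<Longrightarrow> n \<notin> - ?P \<Longrightarrow> blinfun_apply u' (v n) \<le> a"
      using indep[of K ?P] indep[of K "- ?P"] by blast
    have "(b - a) * (\<Sum>n<K. \<bar>c n\<bar>) = (\<Sum>n<K. (b - a) * \<bar>c n\<bar>)"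
      by (simp add: sum_distrib_left)
    also have "\<dots> \<le> (\<Sum>n<K. c n * (blinfun_apply u (v n) - blinfun_apply u' (v n)))"
    proof (rule sum_mono)
      fix n assume "n \<in> {..<K}"
      then have n: "n < K" by simp
      show "(b - a) * \<bar>c n\<bar> \<le> c n * (blinfun_apply u (v n) - blinfun_apply u' (v n))"
      proof (cases "c n \<ge> 0")
        case True
        then have "b - a \<le> blinfun_apply u (v n) - blinfun_apply u' (v n)" using up(1)[OF n] up(4)[OF n] by force
        then show ?thesis using True by (simp add: mult.commute mult_left_mono)
      next
        case False
        then have "b - a \<le> blinfun_apply u' (v n) - blinfun_apply u (v n)" using up(2)[OF n] up(3)[OF n] by force
        then have "(b - a) * - c n \<le> (blinfun_apply u' (v n) - blinfun_apply u (v n)) * - c n"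
          using False by (intro mult_right_mono) auto
        then show ?thesis using False by (simp add: algebra_simps)
      qed
    qed
    also have "\<dots> = blinfun_apply u x - blinfun_apply u' x"
      by (simp add: x_def blinfun.sum_right blinfun.scaleR_right sum_subtractf algebra_simps)
    also have "\<dots> \<le> norm u * norm x + norm u' * norm x"
      using norm_blinfun[of u x] norm_blinfun[of u' x] by simp
    also have "\<dots> \<le> M' * norm x + M' * norm x"
      using u M' by (intro add_mono mult_right_mono) auto
    finally show ?thesis by (simp add: x_def)
  qed
  have lower: "(b - a) * l1_norm c \<le> 2 * M' * norm (J c)" if "c \<in> l1_carrier" for c
  proof (rule LIMSEQ_le)
    show "(\<lambda>K. (b - a) * (\<Sum>n<K. \<bar>c n\<bar>)) \<longlonglongrightarrow> (b - a) * l1_norm c"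
      using that unfolding l1_norm_def l1_carrier_def
      by (intro tendsto_intros summable_LIMSEQ) auto
    show "(\<lambda>K. 2 * M' * norm (\<Sum>n<K. c n *\<^sub>R v n)) \<longlonglongrightarrow> 2 * M' * norm (J c)"
      unfolding J_def by (intro tendsto_intros summable_LIMSEQ summ that)
  qed (use finite_bound in auto)
  have upper: "norm (J c) \<le> B * l1_norm c" if "c \<in> l1_carrier" for c
  proof -
    have s: "summable (\<lambda>n. \<bar>c n\<bar>)" using that by (simp add: l1_carrier_def)
    have "norm (J c) \<le> (\<Sum>n. norm (c n *\<^sub>R v n))"
      unfolding J_def by (rule summable_norm[OF sums[OF that]])
    also have "\<dots> \<le> (\<Sum>n. B * \<bar>c n\<bar>)"
    proof (rule suminf_le)
      show "norm (c n *\<^sub>R v n) \<le> B * \<bar>c n\<bar>" for n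
        using mult_left_mono[OF v[of n], of "\<bar>c n\<bar>"] by (simp add: mult.commute)
    qed (use sums[OF that] s in \<open>auto intro: summable_mult\<close>)
    also have "\<dots> = B * l1_norm c"
      unfolding l1_norm_def by (rule suminf_mult[OF s])
    finally show ?thesis .
  qed
  show ?thesis
    unfolding contains_l1_def
  proof (rule exI[of _ J], rule exI[of _ "(b - a) / (2 * M')"], rule exI[of _ B],
      intro conjI ballI allI)
    fix c d assume "c \<in> l1_carrier" "d \<in> l1_carrier"
    then show "J (\<lambda>n. c n + d n) = J c + J d"
      unfolding J_def by (simp add: scaleR_add_left suminf_add[OF summ summ])
  next
    fix c and r :: real assume "c \<in> l1_carrier"
    then show "J (\<lambda>n. r * c n) = r *\<^sub>R J c"
      unfolding J_def by (simp add: suminf_scaleR_right[OF summ] flip: scaleR_scaleR)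
  next
    fix c assume "c \<in> l1_carrier"
    from lower[OF this] show "(b - a) / (2 * M') * l1_norm c \<le> norm (J c)"
      using M' by (simp add: field_simps)
  next
    fix c assume "c \<in> l1_carrier"
    then show "norm (J c) \<le> B * l1_norm c" by (rule upper)
  qed (use ab M' in auto)
qed

section \<open>Small angles whose powers follow a prescribed sign pattern\<close>

text \<open>The angle is given by its base \<open>N\<close> expansion, with digits \<open>0\<close> and \<open>\<pi>\<close>; multiplication by
  \<open>N\<close> shifts the digits because \<open>N\<close> is even.\<close>

lemma cis_powers_prescribed_signs:
  fixes \<delta> :: real and N :: nat
  assumes "even N" "pi + \<delta> \<le> N * \<delta>" "\<delta> \<ge> 0"
  shows "\<exists>\<theta>\<in>{0..\<delta>}. \<forall>j<K. \<exists>t\<in>{0..\<delta>}. cis \<theta> ^ (N ^ Suc j) = (if j \<in> A then -1 else 1) * cis t"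
proof (induction K arbitrary: A)
  case 0
  then show ?case using assms by auto
next
  case (Suc K)
  \<comment> \<open>The induction hypothesis, applied to the pattern shifted by one, supplies the
    later digits; membership of \<open>0\<close> in \<open>A\<close> decides the new leading digit
    \<open>d\<close>.\<close>
  obtain \<theta> where \<theta>: "\<theta> \<in> {0..\<delta>}"
    and IH: "\<forall>j<K. \<exists>t\<in>{0..\<delta>}. cis \<theta> ^ (N ^ Suc j) = (if Suc j \<in> A then -1 else 1) * cis t"
    using Suc.IH[of "{j. Suc j \<in> A}"] by auto
  define d where "d = (if 0 \<in> A then pi else 0)"
  have cis_d: "cis d = (if 0 \<in> A then -1 else 1)" by (simp add: d_def)
  have d: "0 \<le> d" "d \<le> pi" by (auto simp: d_def)
  have N: "N > 0" using assms pi_gt_zero by (cases "N = 0") auto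
  \<comment> \<open>Prepends the digit. As \<open>d + \<theta>\<close> is at most
    \<open>pi + \<delta>\<close>, the hypothesis on \<open>N\<close> keeps the quotient in the
    interval.\<close>
  define \<theta>' where "\<theta>' = (d + \<theta>) / N"
  have "\<theta>' \<in> {0..\<delta>}"
    using \<theta> d N assms by (auto simp: \<theta>'_def field_simps)
  moreover have step: "cis \<theta>' ^ N = cis d * cis \<theta>"
  proof -
    have "cis \<theta>' ^ N = cis (real N * \<theta>')" by (rule Complex.DeMoivre)
    also have "real N * \<theta>' = d + \<theta>" using N by (simp add: \<theta>'_def)
    finally show ?thesis by (simp add: cis_mult)
  qed
  have "\<exists>t\<in>{0..\<delta>}. cis \<theta>' ^ (N ^ Suc j) = (if j \<in> A then -1 else 1) * cis t" if "j < Suc K" for j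
  proof (cases j)
    case 0
    then show ?thesis using step \<theta> cis_d by auto
  next
    case (Suc i)
    have "cis \<theta>' ^ (N ^ Suc j) = (cis d * cis \<theta>) ^ (N ^ Suc i)"
      by (simp add: Suc step power_mult)
    also have "\<dots> = cis d ^ (N ^ Suc i) * cis \<theta> ^ (N ^ Suc i)"
      by (rule power_mult_distrib)
    \<comment> \<open>The leading digit only contributes a sign, and the exponent is even, so it
      does not disturb the later powers.\<close>
    also have "cis d ^ (N ^ Suc i) = 1"
      using assms(1) by (simp add: cis_d)
    finally show ?thesis using IH Suc that by auto
  qed
  ultimately show ?case by blast
qed

section \<open>The group of surjective linear isometries\<close>

lemma isometry_groupD:
  "f \<in> carrier isometry_group \<Longrightarrow> norm (blinfun_apply f v) = norm v"
  by (simp add: isometry_group_def)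

text \<open>A norm-preserving linear map is injective, and the set-theoretic inverse of a surjective
  one inherits linearity and the norm identity. Hence the \<open>inv\<close> in
  \<open>dual_action\<close> is again an isometry when taken at an isometry.\<close>

lemma group_isometry_group: "group (isometry_group :: ('v::real_normed_vector \<Rightarrow>\<^sub>L 'v) monoid)"
proof (rule groupI)
  fix f :: "'v \<Rightarrow>\<^sub>L 'v" assume f: "f \<in> carrier isometry_group"
  then have norm_f: "norm (f v) = norm v" and surj: "surj f" for v
    by (auto simp: isometry_group_def)
  have "inj f"
  proof (rule injI)
    fix x y assume "f x = f y"
    then show "x = y" using norm_f[of "x - y"] by (simp add: blinfun.diff_right)
  qed
  define g where "g = inv_into UNIV f"
  have g: "f (g x) = x" "g (f x) = x" for x
    using \<open>inj f\<close> surj by (auto simp: surj_f_inv_f g_def)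
  have lin: "bounded_linear g"
  proof (rule bounded_linear_intro[where K = 1])
    show "g (x + y) = g x + g y" for x y
      by (metis g blinfun.add_right)
    show "g (r *\<^sub>R x) = r *\<^sub>R g x" for r x
      by (metis g blinfun.scaleR_right)
    show "norm (g x) \<le> norm x * 1" for x
      by (metis g(1) norm_f mult_1_right order_refl)
  qed
  have "surj g"
    by (rule surjI[of _ f]) (rule g)
  moreover have "norm (g v) = norm v" for v
    by (metis g(1) norm_f)
  ultimately show "\<exists>g\<in>carrier isometry_group. g \<otimes>\<^bsub>isometry_group\<^esub> f = \<one>\<^bsub>isometry_group\<^esub>"
    by (intro bexI[of _ "Blinfun g"])
      (auto simp: isometry_group_def bounded_linear_Blinfun_apply lin g intro!: blinfun_eqI)
next
  fix f g h :: "'v \<Rightarrow>\<^sub>L 'v"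
  assume "f \<in> carrier isometry_group" "g \<in> carrier isometry_group"
  then show "f \<otimes>\<^bsub>isometry_group\<^esub> g \<in> carrier isometry_group"
    using comp_surj[of g f] by (auto simp: isometry_group_def comp_def)
qed (auto simp: isometry_group_def intro!: blinfun_eqI)

section \<open>The shear group\<close>

lemma carrier_torus: "carrier torus = sphere 0 1 \<times> sphere 0 1"
  by (auto simp: torus_def circle_group_def DirProd_def)

lemma mult_torus: "(z, w) \<otimes>\<^bsub>torus\<^esub> (z', w') = (z * z', w * w')"
  by (auto simp: torus_def circle_group_def DirProd_def)

lemma one_torus: "\<one>\<^bsub>torus\<^esub> = (1, 1)"
  by (auto simp: torus_def circle_group_def DirProd_def)

lemma group_torus: "group torus"
proof (rule groupI)
  fix x assume "x \<in> carrier torus"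
  then show "\<exists>y\<in>carrier torus. y \<otimes>\<^bsub>torus\<^esub> x = \<one>\<^bsub>torus\<^esub>"
    by (intro bexI[of _ "(inverse (fst x), inverse (snd x))"])
       (auto simp: carrier_torus mult_torus one_torus norm_inverse intro!: left_inverse)
qed (auto simp: carrier_torus mult_torus one_torus norm_mult)

text \<open>Closed form of all integer powers of the shear. The restriction makes it extensional, as
  membership in \<open>auto torus\<close> requires.\<close>

definition torus_shear :: "int \<Rightarrow> complex \<times> complex \<Rightarrow> complex \<times> complex" where
  "torus_shear k = restrict (\<lambda>(z, w). (z, z powi k * w)) (carrier torus)"

lemma torus_shear_apply:
  "z \<in> sphere 0 1 \<Longrightarrow> w \<in> sphere 0 1 \<Longrightarrow> torus_shear k (z, w) = (z, z powi k * w)"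
  by (simp add: torus_shear_def carrier_torus)

lemma torus_shear_closed: "x \<in> carrier torus \<Longrightarrow> torus_shear k x \<in> carrier torus"
  by (auto simp: carrier_torus torus_shear_apply norm_mult norm_power_int)

lemma torus_shear_add:
  "x \<in> carrier torus \<Longrightarrow> torus_shear k (torus_shear l x) = torus_shear (k + l) x"
proof -
  have "z powi (k + l) = z powi k * z powi l" if "norm z = 1" for z :: complex
    using that by (intro power_int_add) auto
  moreover assume "x \<in> carrier torus"
  ultimately show ?thesis
    by (auto simp: carrier_torus torus_shear_apply norm_mult norm_power_int)
qed

lemma torus_shear_zero: "x \<in> carrier torus \<Longrightarrow> torus_shear 0 x = x"
  by (auto simp: carrier_torus torus_shear_apply)

lemma torus_shear_mult:
  "x \<in> carrier torus \<Longrightarrow> y \<in> carrier torus \<Longrightarrow>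
    torus_shear k (x \<otimes>\<^bsub>torus\<^esub> y) = torus_shear k x \<otimes>\<^bsub>torus\<^esub> torus_shear k y"
  by (auto simp: carrier_torus torus_shear_apply mult_torus norm_mult power_int_mult_distrib)

lemma torus_shear_auto: "torus_shear k \<in> auto torus"
proof -
  have "bij_betw (torus_shear k) (carrier torus) (carrier torus)"
    by (rule bij_betw_byWitness[where f' = "torus_shear (- k)"])
       (auto simp: torus_shear_add torus_shear_zero torus_shear_closed)
  then show ?thesis
    by (auto simp: auto_def Bij_def hom_def torus_shear_mult torus_shear_closed)
       (simp add: torus_shear_def)
qed

lemma torus_shear_hom: "torus_shear \<in> hom integer_group (AutoGroup torus)"
proof (rule homI)
  fix k l :: int
  have "compose (carrier torus) (torus_shear k) (torus_shear l) = torus_shear (k + l)"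
    by (auto simp: compose_def fun_eq_iff torus_shear_add) (simp add: torus_shear_def)
  then show "torus_shear (k \<otimes>\<^bsub>integer_group\<^esub> l)
      = torus_shear k \<otimes>\<^bsub>AutoGroup torus\<^esub> torus_shear l"
    using torus_shear_auto by (simp add: AutoGroup_def BijGroup_def auto_def)
qed (simp add: AutoGroup_def torus_shear_auto)

text \<open>A homomorphism from the integers is determined by its value at \<open>1\<close>. This
  replaces the abstract power in \<open>torus_semidirect\<close> by an explicit formula.\<close>

lemma torus_shear_pow: "torus_shear 1 [^]\<^bsub>AutoGroup torus\<^esub> (k::int) = torus_shear k"
proof -
  interpret group_hom integer_group "AutoGroup torus" torus_shear
    by (simp add: group_hom_def group_hom_axioms_def torus_shear_hom group.AutoGroup group_torus)
  show ?thesis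
    using hom_int_pow[of 1 k] by simp
qed

section \<open>The semidirect product, its inverses and its cosets\<close>

definition shear_group :: "((complex \<times> complex) \<times> int) monoid" where
  "shear_group = torus_semidirect (torus_shear 1)"

lemma carrier_shear_group: "carrier shear_group = carrier torus \<times> UNIV"
  by (simp add: shear_group_def torus_semidirect_def semidirect_product_def)

lemma mult_shear_group:
  "(x, k) \<otimes>\<^bsub>shear_group\<^esub> (y, l) = (x \<otimes>\<^bsub>torus\<^esub> torus_shear k y, k + l)"
  by (simp add: shear_group_def torus_semidirect_def semidirect_product_def torus_shear_pow)

lemma one_shear_group: "\<one>\<^bsub>shear_group\<^esub> = (\<one>\<^bsub>torus\<^esub>, 0)"
  by (simp add: shear_group_def torus_semidirect_def semidirect_product_def)

text \<open>In \<open>(y, l) (x, k) = 1\<close> the second coordinate forces \<open>l = -k\<close>,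
  and then \<open>y\<close> is the inverse of \<open>torus_shear (-k) x\<close>, that is, the shear
  of the inverse of \<open>x\<close>. The equation is phrased as a left inverse because it serves to
  prove that \<open>shear_group\<close> is a group.\<close>

lemma inverse_shear_group:
  assumes "x \<in> carrier torus"
  shows "(torus_shear (- k) (inv\<^bsub>torus\<^esub> x), - k) \<otimes>\<^bsub>shear_group\<^esub> (x, k) = \<one>\<^bsub>shear_group\<^esub>"
proof -
  interpret group torus by (rule group_torus)
  show ?thesis
    using assms torus_shear_mult[of "inv\<^bsub>torus\<^esub> x" x "-k"]
    by (simp add: mult_shear_group one_shear_group)
       (simp add: torus_shear_def carrier_torus one_torus)
qed

lemma group_shear_group: "group shear_group"
proof -
  interpret group torus by (rule group_torus)
  show ?thesis
  proof (rule groupI)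
    fix x assume "x \<in> carrier shear_group"
    then obtain y k where x: "x = (y, k)" "y \<in> carrier torus"
      by (auto simp: carrier_shear_group)
    then show "\<exists>y\<in>carrier shear_group. y \<otimes>\<^bsub>shear_group\<^esub> x = \<one>\<^bsub>shear_group\<^esub>"
      by (intro bexI[of _ "(torus_shear (- k) (inv\<^bsub>torus\<^esub> y), - k)"])
         (simp_all add: inverse_shear_group carrier_shear_group torus_shear_closed)
  qed (auto simp: carrier_shear_group mult_shear_group one_shear_group torus_shear_closed
        torus_shear_mult torus_shear_add torus_shear_zero m_assoc)
qed

lemma inv_shear_group:
  assumes "x \<in> carrier torus"
  shows "inv\<^bsub>shear_group\<^esub> (x, k) = (torus_shear (- k) (inv\<^bsub>torus\<^esub> x), - k)"
proof -
  interpret T: group torus by (rule group_torus)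
  interpret group shear_group by (rule group_shear_group)
  show ?thesis
    using assms by (intro inv_equality inverse_shear_group)
      (simp_all add: carrier_shear_group torus_shear_closed)
qed

lemma subgroup_integer_subgroup: "subgroup integer_subgroup shear_group"
proof -
  interpret T: group torus by (rule group_torus)
  interpret group shear_group by (rule group_shear_group)
  have *: "torus_shear k \<one>\<^bsub>torus\<^esub> = \<one>\<^bsub>torus\<^esub>" for k
    by (simp add: one_torus torus_shear_apply)
  show ?thesis
    by unfold_locales
      (auto simp: integer_subgroup_def carrier_shear_group mult_shear_group one_shear_group
         inv_shear_group *)
qed

text \<open>Translation by \<open>k\<close> maps the integers onto themselves, so only the torus
  coordinate moves. A general \<open>y\<close> covers both the cosets of the subgroup and the action
  of the group on them.\<close>

lemma coset_shear_group:
  assumes "x \<in> carrier torus"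
  shows "(x, k) <#\<^bsub>shear_group\<^esub> ({y} \<times> UNIV) = {x \<otimes>\<^bsub>torus\<^esub> torus_shear k y} \<times> UNIV"
proof -
  have "\<exists>l'. l = k + l'" for l by (rule exI[of _ "l - k"]) simp
  then show ?thesis by (auto simp: l_coset_def mult_shear_group)
qed

lemma coset_integer_subgroup:
  assumes "x \<in> carrier torus"
  shows "(x, k) <#\<^bsub>shear_group\<^esub> integer_subgroup = {x} \<times> UNIV"
proof -
  interpret T: group torus by (rule group_torus)
  show ?thesis
    using assms by (simp add: integer_subgroup_def coset_shear_group one_torus torus_shear_apply)
      (simp flip: one_torus)
qed

section \<open>Topology of the shear group and of its quotient\<close>

lemma euclidean_discrete: "(euclidean :: 'a::discrete_topology topology) = discrete_topology UNIV"
  using discrete_topology_unique[of UNIV "euclidean :: 'a topology"] by (auto simp: open_discrete)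

lemma torus_topology_eq: "torus_topology = top_of_set (carrier torus)"
  by (simp add: torus_topology_def carrier_torus)

text \<open>The integers carry the discrete topology as a type, so the product is a Euclidean
  subspace and continuity can be treated by \<open>continuous_on\<close>.\<close>

lemma torus_semidirect_topology_eq:
  "torus_semidirect_topology = top_of_set (carrier torus \<times> (UNIV :: int set))"
  using prod_topology_subtopology_eu[of "carrier torus" "UNIV :: int set"]
  unfolding torus_semidirect_topology_def torus_topology_eq euclidean_discrete[symmetric]
  by simp

lemma tychonoff_space_metrizable: "metrizable_space X \<Longrightarrow> tychonoff_space X"
  by (simp add: tychonoff_space_def metrizable_imp_Hausdorff_space
      metrizable_imp_completely_regular_space)

lemma homeomorphic_tychonoff_space:
  "X homeomorphic_space Y \<Longrightarrow> tychonoff_space X \<Longrightarrow> tychonoff_space Y"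
  using homeomorphic_Hausdorff_space[of X Y] homeomorphic_completely_regular_space[of X Y]
  by (simp add: tychonoff_space_def)

text \<open>Near \<open>(x, k)\<close> the second coordinate is constantly \<open>k\<close>, so only
  the slice at \<open>k\<close> matters for the limit.\<close>

lemma continuous_on_Times_discrete:
  fixes f :: "'a::topological_space \<times> 'k::discrete_topology \<Rightarrow> 'b::topological_space"
  assumes "\<And>k. continuous_on S (\<lambda>x. f (x, k))"
  shows "continuous_on (S \<times> UNIV) f"
  unfolding continuous_on_def
proof (clarify)
  fix x :: 'a and k :: 'k assume "x \<in> S"
  have "eventually (\<lambda>p. snd p = k) (at (x, k) within S \<times> UNIV)"
    using tendsto_snd[OF tendsto_ident_at[of "(x, k)" "S \<times> UNIV"]] by (simp add: tendsto_discrete)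
  then have eq: "eventually (\<lambda>p. f (fst p, k) = f p) (at (x, k) within S \<times> UNIV)"
    by eventually_elim (metis prod.collapse)
  have lim: "((\<lambda>p. f (fst p, k)) \<longlongrightarrow> f (x, k)) (at (x, k) within S \<times> UNIV)"
  proof -
    have "continuous_on (S \<times> UNIV) (\<lambda>p :: 'a \<times> 'k. f (fst p, k))"
      by (rule continuous_on_compose2[OF assms[of k]]) (auto intro: continuous_intros)
    then show ?thesis using \<open>x \<in> S\<close> by (auto simp: continuous_on_def)
  qed
  from lim eq show "(f \<longlongrightarrow> f (x, k)) (at (x, k) within S \<times> UNIV)"
    by (rule Lim_transform_eventually)
qed

lemma continuous_on_torus_shear:
  "continuous_on (carrier torus \<times> UNIV) (\<lambda>(x, k). torus_shear k x)"
proof (rule continuous_on_Times_discrete)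
  fix k
  have "continuous_on (carrier torus) (\<lambda>(z, w). (z, z powi k * w))"
    unfolding case_prod_unfold by (auto simp: carrier_torus intro!: continuous_intros)
  then show "continuous_on (carrier torus) (\<lambda>x. case (x, k) of (x, k) \<Rightarrow> torus_shear k x)"
    by (rule continuous_on_eq) (auto simp: torus_shear_def)
qed

lemma continuous_on_torus_action:
  "continuous_on ((carrier torus \<times> UNIV) \<times> carrier torus)
    (\<lambda>((x, k), y). x \<otimes>\<^bsub>torus\<^esub> torus_shear k y)"
proof -
  have "continuous_on ((carrier torus \<times> UNIV) \<times> carrier torus)
      (\<lambda>p. (\<lambda>(x, k). torus_shear k x) (snd p, snd (fst p)))"
    by (rule continuous_on_compose2[OF continuous_on_torus_shear]) (auto intro!: continuous_intros)
  moreover have "x \<otimes>\<^bsub>torus\<^esub> y = (fst x * fst y, snd x * snd y)" for x y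
    by (cases x; cases y) (simp add: mult_torus)
  ultimately show ?thesis
    by (auto simp: case_prod_unfold intro!: continuous_intros)
qed

lemma inv_torus: "x \<in> carrier torus \<Longrightarrow> inv\<^bsub>torus\<^esub> x = (inverse (fst x), inverse (snd x))"
  by (rule group.inv_equality[OF group_torus])
     (auto simp: carrier_torus mult_torus one_torus norm_inverse intro!: left_inverse)

lemma tychonoff_torus_topology: "tychonoff_space torus_topology"
  by (simp add: torus_topology_eq tychonoff_space_metrizable metrizable_space_subtopology
      metrizable_space_euclidean)

lemma tychonoff_torus_semidirect_topology: "tychonoff_space torus_semidirect_topology"
  by (simp add: torus_semidirect_topology_def torus_topology_eq tychonoff_space_metrizable
      metrizable_space_prod_topology metrizable_space_subtopology metrizable_space_euclidean)

lemma topological_group_shear_group: "topological_group shear_group torus_semidirect_topology"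
proof -
  let ?S = "carrier torus \<times> (UNIV :: int set)"
  have "continuous_on (?S \<times> ?S) (\<lambda>(x, y). x \<otimes>\<^bsub>shear_group\<^esub> y)"
  proof -
    have "continuous_on (?S \<times> ?S)
        (\<lambda>p. (\<lambda>((x, k), y). x \<otimes>\<^bsub>torus\<^esub> torus_shear k y) (fst p, fst (snd p)))"
      by (rule continuous_on_compose2[OF continuous_on_torus_action])
         (auto intro!: continuous_intros)
    moreover have "continuous_on (?S \<times> ?S) (\<lambda>p. snd (fst p) + snd (snd p))"
      by (rule continuous_on_compose2[of UNIV "\<lambda>(k, l :: int). k + l" _ "\<lambda>p. (snd (fst p), snd (snd p))",
            simplified])
         (auto intro!: continuous_intros continuous_on_Times_discrete[of UNIV, simplified])
    ultimately have "continuous_on (?S \<times> ?S) (\<lambda>p. ((\<lambda>((x, k), y). x \<otimes>\<^bsub>torus\<^esub> torus_shear k y) (fst p, fst (snd p)),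
        snd (fst p) + snd (snd p)))"
      by (rule continuous_on_Pair)
    then show ?thesis
      by (rule continuous_on_eq) (auto simp: mult_shear_group)
  qed
  moreover have "continuous_on ?S (\<lambda>x. inv\<^bsub>shear_group\<^esub> x)"
  proof -
    interpret T: group torus by (rule group_torus)
    have "continuous_on (carrier torus) (\<lambda>x. inv\<^bsub>torus\<^esub> x)"
    proof -
      have "continuous_on (carrier torus) (\<lambda>x. (inverse (fst x), inverse (snd x)))"
        by (auto simp: carrier_torus intro!: continuous_intros)
      then show ?thesis by (rule continuous_on_eq) (simp add: inv_torus)
    qed
    then have 1: "continuous_on ?S (\<lambda>p. inv\<^bsub>torus\<^esub> (fst p))"
      by (rule continuous_on_compose2) (auto intro!: continuous_intros)
    have 2: "continuous_on ?S (\<lambda>p. - snd p)"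
      by (rule continuous_on_compose2[of UNIV uminus]) (auto intro!: continuous_intros)
    have "continuous_on ?S (\<lambda>p. (\<lambda>(x, k). torus_shear k x) (inv\<^bsub>torus\<^esub> (fst p), - snd p))"
      by (rule continuous_on_compose2[OF continuous_on_torus_shear continuous_on_Pair[OF 1 2]]) auto
    from continuous_on_Pair[OF this 2] show ?thesis
      by (rule continuous_on_eq) (auto simp: inv_shear_group)
  qed
  \<comment> \<open>Besides \<open>continuous_on\<close>, a \<open>continuous_map\<close> between
    subspaces must map into the target.\<close>
  moreover have "(\<lambda>(x, y). x \<otimes>\<^bsub>shear_group\<^esub> y) \<in> ?S \<times> ?S \<rightarrow> ?S" "(\<lambda>x. inv\<^bsub>shear_group\<^esub> x) \<in> ?S \<rightarrow> ?S"
    using group.inv_closed[OF group_shear_group] monoid.m_closed[OF group.is_monoid[OF group_shear_group]]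
    by (auto simp: Pi_def simp flip: carrier_shear_group)
  ultimately show ?thesis
    by (auto simp: topological_group_def group_shear_group torus_semidirect_topology_eq
        carrier_shear_group tychonoff_torus_semidirect_topology[unfolded torus_semidirect_topology_eq])
qed

lemma topological_group_automorphism_torus_shear:
  "topological_group_automorphism torus torus_topology (torus_shear k)"
proof -
  have cont: "continuous_map torus_topology torus_topology (torus_shear l)" for l
  proof -
    have "continuous_on (carrier torus) (\<lambda>x. (\<lambda>(x, k). torus_shear k x) (x, l))"
      by (rule continuous_on_compose2[OF continuous_on_torus_shear]) (auto intro!: continuous_intros)
    then show ?thesis
      by (simp add: torus_topology_eq torus_shear_closed)
  qed
  have "homeomorphic_maps torus_topology torus_topology (torus_shear k) (torus_shear (- k))"
    using cont by (auto simp: homeomorphic_maps_def torus_topology_eq torus_shear_add torus_shear_zero)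
  then show ?thesis
    by (auto simp: topological_group_automorphism_def torus_shear_auto homeomorphic_map_maps)
qed

lemma subtopology_integer_subgroup:
  "subtopology torus_semidirect_topology integer_subgroup = discrete_topology integer_subgroup"
proof -
  have H: "integer_subgroup \<subseteq> carrier torus \<times> UNIV"
    by (auto simp: integer_subgroup_def one_torus carrier_torus)
  have "openin (top_of_set integer_subgroup) {x}" if "x \<in> integer_subgroup" for x
  proof -
    \<comment> \<open>Each point of the subgroup is cut out by the open slab at its own integer
      level.\<close>
    have "{x} = integer_subgroup \<inter> (UNIV \<times> {snd x})"
      using that unfolding integer_subgroup_def by (cases x) (simp; blast)
    then show ?thesis
      by (metis open_Times open_UNIV open_discrete openin_open_Int)
  qed
  moreover have "subtopology torus_semidirect_topology integer_subgroup = top_of_set integer_subgroup"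
    using H by (simp add: torus_semidirect_topology_eq subtopology_subtopology Int_absorb1)
  ultimately show ?thesis
    using discrete_topology_unique[of integer_subgroup "top_of_set integer_subgroup"]  by auto
qed

section \<open>The quotient \<open>G/H\<close> as a copy of the torus\<close>

definition torus_coset :: "complex \<times> complex \<Rightarrow> ((complex \<times> complex) \<times> int) set" where
  "torus_coset x = {x} \<times> UNIV"

lemma left_cosets_shear_group:
  "left_cosets shear_group integer_subgroup = torus_coset ` carrier torus"
proof -
  have "left_cosets shear_group integer_subgroup = (torus_coset \<circ> fst) ` (carrier torus \<times> (UNIV :: int set))"
    unfolding left_cosets_def carrier_shear_group
    by (rule image_cong) (auto simp: coset_integer_subgroup torus_coset_def)
  then show ?thesis by (simp only: image_comp[symmetric]) simp
qed

abbreviation shear_quotient :: "((complex \<times> complex) \<times> int) set topology" where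
  "shear_quotient \<equiv> coset_topology shear_group torus_semidirect_topology integer_subgroup"

text \<open>The preimage in the group of a set of cosets is a cylinder over all integers, and such a
  cylinder is open exactly when its base is open in the torus.\<close>

lemma openin_shear_quotient:
  "openin shear_quotient U \<longleftrightarrow> U \<subseteq> torus_coset ` carrier torus \<and>
     openin torus_topology {x \<in> carrier torus. torus_coset x \<in> U}"
proof -
  have "{g \<in> topspace torus_semidirect_topology. g <#\<^bsub>shear_group\<^esub> integer_subgroup \<in> U}
      = {x \<in> carrier torus. torus_coset x \<in> U} \<times> UNIV"
    by (auto simp: torus_semidirect_topology_eq coset_integer_subgroup torus_coset_def)
  moreover have "openin torus_semidirect_topology (A \<times> UNIV) \<longleftrightarrow> openin torus_topology A" for A
    by (auto simp: torus_semidirect_topology_def openin_prod_Times_iff)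
  ultimately show ?thesis
    by (simp add: openin_coset_topology left_cosets_shear_group)
qed

lemma torus_coset_eq_iff: "torus_coset x = torus_coset y \<longleftrightarrow> x = y"
  by (auto simp: torus_coset_def)

lemma topspace_shear_quotient: "topspace shear_quotient = torus_coset ` carrier torus"
proof -
  have "{x \<in> carrier torus. torus_coset x \<in> torus_coset ` carrier torus} = carrier torus"
    by auto
  then have "openin shear_quotient (torus_coset ` carrier torus)"
    by (simp add: openin_shear_quotient torus_topology_eq)
  then have "torus_coset ` carrier torus \<subseteq> topspace shear_quotient"
    by (rule openin_subset)
  moreover have "topspace shear_quotient \<subseteq> torus_coset ` carrier torus"
    using openin_topspace[of shear_quotient] unfolding openin_shear_quotient by blast
  ultimately show ?thesis by blast
qed

text \<open>By \<open>openin_shear_quotient\<close>, open sets correspond under the bijection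
  \<open>torus_coset\<close>. Through this map the quotient receives compactness, the Tychonoff
  property and its charts from the torus.\<close>

lemma homeomorphic_map_torus_coset: "homeomorphic_map torus_topology shear_quotient torus_coset"
proof (rule bijective_open_imp_homeomorphic_map)
  show "continuous_map torus_topology shear_quotient torus_coset"
    by (auto simp: continuous_map_def openin_shear_quotient topspace_shear_quotient torus_topology_eq)
  show "open_map torus_topology shear_quotient torus_coset"
    unfolding open_map_def openin_shear_quotient
  proof (intro allI impI conjI)
    fix U assume U: "openin torus_topology U"
    then have *: "U \<subseteq> carrier torus" using openin_subset by (fastforce simp: torus_topology_eq)
    then show "torus_coset ` U \<subseteq> torus_coset ` carrier torus" by blast
    have "{x \<in> carrier torus. torus_coset x \<in> torus_coset ` U} = U"
      using * by (auto simp: torus_coset_eq_iff image_iff)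
    with U show "openin torus_topology {x \<in> carrier torus. torus_coset x \<in> torus_coset ` U}" by simp
  qed
qed (auto simp: topspace_shear_quotient torus_topology_eq inj_on_def torus_coset_eq_iff)

lemma coset_torus_coset:
  "x \<in> carrier torus \<Longrightarrow>
    (x, k) <#\<^bsub>shear_group\<^esub> torus_coset y = torus_coset (x \<otimes>\<^bsub>torus\<^esub> torus_shear k y)"
  by (simp add: torus_coset_def coset_shear_group)

lemma g_space_shear_quotient:
  "g_space shear_group torus_semidirect_topology shear_quotient (\<lambda>g C. g <#\<^bsub>shear_group\<^esub> C)"
proof -
  interpret T: group torus by (rule group_torus)
  let ?T = torus_semidirect_topology and ?X = shear_quotient
  \<comment> \<open>With the inverse homeomorphism \<open>q\<close>, the action on cosets is
    conjugate to the affine action \<open>x \<otimes> torus_shear k y\<close> on the torus, whose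
    continuity is already known.\<close>
  obtain q where "homeomorphic_maps torus_topology ?X torus_coset q"
    using homeomorphic_map_torus_coset homeomorphic_map_maps by blast
  then have p: "continuous_map torus_topology ?X torus_coset" and q: "continuous_map ?X torus_topology q"
    and qp: "\<And>x. x \<in> carrier torus \<Longrightarrow> q (torus_coset x) = x"
    by (auto simp: homeomorphic_maps_def torus_topology_eq)
  have "continuous_map (prod_topology ?T torus_topology) torus_topology
      (\<lambda>((x, k), y). x \<otimes>\<^bsub>torus\<^esub> torus_shear k y)"
    using continuous_on_torus_action
    by (auto simp: torus_semidirect_topology_eq torus_topology_eq torus_shear_closed)
  moreover have "continuous_map (prod_topology ?T ?X) (prod_topology ?T torus_topology) (\<lambda>(g, C). (g, q C))"
    using q by (simp add: continuous_map_prod_top)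
  ultimately have "continuous_map (prod_topology ?T ?X) ?X
      (torus_coset \<circ> (\<lambda>((x, k), y). x \<otimes>\<^bsub>torus\<^esub> torus_shear k y) \<circ> (\<lambda>(g, C). (g, q C)))"
    using p by (meson continuous_map_compose)
  then have "continuous_map (prod_topology ?T ?X) ?X (\<lambda>(g, C). g <#\<^bsub>shear_group\<^esub> C)"
  proof (rule continuous_map_eq)
    fix p assume "p \<in> topspace (prod_topology ?T ?X)"
    then obtain x k y where "p = ((x, k), torus_coset y)" "x \<in> carrier torus" "y \<in> carrier torus"
      unfolding topspace_prod_topology topspace_shear_quotient
      by (auto simp: torus_semidirect_topology_eq)
    then show "(torus_coset \<circ> (\<lambda>((x, k), y). x \<otimes>\<^bsub>torus\<^esub> torus_shear k y) \<circ> (\<lambda>(g, C). (g, q C))) p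
        = (\<lambda>(g, C). g <#\<^bsub>shear_group\<^esub> C) p"
      by (simp add: qp coset_torus_coset)
  qed
  moreover have "tychonoff_space ?X"
  proof (rule homeomorphic_tychonoff_space)
    show "torus_topology homeomorphic_space ?X"
      using homeomorphic_map_torus_coset by (rule homeomorphic_map_imp_homeomorphic_space)
    show "tychonoff_space torus_topology"
      by (rule tychonoff_torus_topology)
  qed
  moreover have "(g \<otimes>\<^bsub>shear_group\<^esub> h) <#\<^bsub>shear_group\<^esub> C = g <#\<^bsub>shear_group\<^esub> (h <#\<^bsub>shear_group\<^esub> C)"
    if "g \<in> carrier shear_group" "h \<in> carrier shear_group" "C \<in> topspace ?X" for g h C
    using that
    by (auto simp: topspace_shear_quotient carrier_shear_group mult_shear_group coset_torus_coset
        torus_shear_closed torus_shear_mult torus_shear_add T.m_assoc)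
  moreover have "\<one>\<^bsub>shear_group\<^esub> <#\<^bsub>shear_group\<^esub> C = C" if "C \<in> topspace ?X" for C
    using that by (auto simp: topspace_shear_quotient one_shear_group coset_torus_coset torus_shear_zero)
  ultimately show ?thesis
    by (simp add: g_space_def topological_group_shear_group)
qed

lemma compact_space_shear_quotient: "compact_space shear_quotient"
proof -
  have "compact (carrier torus)" by (simp add: carrier_torus compact_Times)
  then have "compact_space torus_topology" by (simp add: torus_topology_eq compact_space_subtopology)
  then show ?thesis
    using homeomorphic_compact_space homeomorphic_map_torus_coset homeomorphic_map_imp_homeomorphic_space
    by blast
qed

section \<open>Surfaces\<close>

lemma second_countable_prod_topology:
  assumes "second_countable X" "second_countable Y"
  shows "second_countable (prod_topology X Y)"
proof -
  obtain \<B> \<C> where \<B>: "countable \<B>" "\<And>V. V \<in> \<B> \<Longrightarrow> openin X V"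
      "\<And>U x. openin X U \<Longrightarrow> x \<in> U \<Longrightarrow> \<exists>V\<in>\<B>. x \<in> V \<and> V \<subseteq> U"
    and \<C>: "countable \<C>" "\<And>V. V \<in> \<C> \<Longrightarrow> openin Y V"
      "\<And>U y. openin Y U \<Longrightarrow> y \<in> U \<Longrightarrow> \<exists>V\<in>\<C>. y \<in> V \<and> V \<subseteq> U"
    using assms unfolding second_countable_def by metis
  show ?thesis
    unfolding second_countable_def
  proof (intro exI conjI ballI allI impI)
    show "countable ((\<lambda>(U, V). U \<times> V) ` (\<B> \<times> \<C>))" using \<B>(1) \<C>(1) by simp
    show "openin (prod_topology X Y) W" if "W \<in> (\<lambda>(U, V). U \<times> V) ` (\<B> \<times> \<C>)" for W
      using that \<B>(2) \<C>(2) by (auto simp: openin_prod_Times_iff)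
  next
    fix W and p assume "openin (prod_topology X Y) W \<and> p \<in> W"
    then obtain U V where UV: "openin X U" "openin Y V" "fst p \<in> U" "snd p \<in> V" "U \<times> V \<subseteq> W"
      by (metis openin_prod_topology_alt prod.collapse)
    obtain U' V' where "U' \<in> \<B>" "fst p \<in> U'" "U' \<subseteq> U" "V' \<in> \<C>" "snd p \<in> V'" "V' \<subseteq> V"
      using \<B>(3)[OF UV(1,3)] \<C>(3)[OF UV(2,4)] by blast
    then show "\<exists>V\<in>(\<lambda>(U, V). U \<times> V) ` (\<B> \<times> \<C>). p \<in> V \<and> V \<subseteq> W"
      using UV(5) by (intro bexI[of _ "U' \<times> V'"]) (auto simp: mem_Times_iff)
  qed
qed

lemma second_countable_euclidean:
  "second_countable (euclidean :: 'a::second_countable_topology topology)"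
proof -
  obtain \<B> :: "'a set set" where \<B>: "countable \<B>" "\<And>C. C \<in> \<B> \<Longrightarrow> open C"
    "\<And>S. open S \<Longrightarrow> \<exists>U. U \<subseteq> \<B> \<and> S = \<Union>U"
    using univ_second_countable by blast
  have "\<exists>V\<in>\<B>. x \<in> V \<and> V \<subseteq> S" if "open S" "x \<in> S" for S x
    using \<B>(3)[OF that(1)] that(2) by blast
  then show ?thesis
    unfolding second_countable_def using \<B>(1,2) by (intro exI[of _ \<B>]) simp
qed

lemma homeomorphic_imp_homeomorphic_space:
  assumes "S homeomorphic T"
  shows "top_of_set S homeomorphic_space top_of_set T"
proof -
  obtain f g where "homeomorphism S T f g"
    using assms unfolding homeomorphic_def by blast
  then have "homeomorphic_maps (top_of_set S) (top_of_set T) f g"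
    by (auto simp: homeomorphism_def homeomorphic_maps_def)
  then show ?thesis
    unfolding homeomorphic_space_def by blast
qed

lemma homeomorphic_topological_2_manifold:
  assumes "X homeomorphic_space Y" "topological_2_manifold X"
  shows "topological_2_manifold Y"
proof -
  obtain f where f: "homeomorphic_map X Y f"
    using assms(1) homeomorphic_space by blast
  have "\<exists>V. \<exists>W :: (real ^ 2) set. openin Y V \<and> y \<in> V \<and> open W \<and>
      subtopology Y V homeomorphic_space top_of_set W" if y: "y \<in> topspace Y" for y
  proof -
    obtain x where x: "x \<in> topspace X" "y = f x"
      using f y homeomorphic_imp_surjective_map by blast
    then obtain U and W :: "(real ^ 2) set" where U: "openin X U" "x \<in> U" and W: "open W"
      "subtopology X U homeomorphic_space top_of_set W"
      using assms(2) unfolding topological_2_manifold_def by blast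
    have "f ` (topspace X \<inter> U) = topspace Y \<inter> f ` U"
      using openin_subset[OF U(1)] homeomorphic_imp_surjective_map[OF f] by blast
    then have "homeomorphic_map (subtopology X U) (subtopology Y (f ` U)) f"
      by (rule homeomorphic_map_subtopologies[OF f])
    then have "subtopology Y (f ` U) homeomorphic_space top_of_set W"
      using W(2) homeomorphic_map_imp_homeomorphic_space homeomorphic_space_sym homeomorphic_space_trans
      by blast
    then show ?thesis
      using U x W(1) homeomorphic_map_openness[OF f openin_subset[OF U(1)]] by blast
  qed
  then show ?thesis
    using assms homeomorphic_Hausdorff_space homeomorphic_space_second_countability
    unfolding topological_2_manifold_def by blast
qed

text \<open>A chart at \<open>(x, k)\<close> is a chart of \<open>X\<close> at \<open>x\<close>,
  placed on the open slice \<open>U \<times> {k}\<close>; countably many slices preserve second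
  countability. This makes the semidirect product itself a surface.\<close>

lemma topological_2_manifold_Times_discrete:
  assumes X: "topological_2_manifold X" and "countable K"
  shows "topological_2_manifold (prod_topology X (discrete_topology K))"
  unfolding topological_2_manifold_def
proof (intro conjI ballI)
  show "Hausdorff_space (prod_topology X (discrete_topology K))"
    using X by (simp add: topological_2_manifold_def Hausdorff_space_prod_topology)
  show "second_countable (prod_topology X (discrete_topology K))"
    using assms
    by (simp add: topological_2_manifold_def second_countable_prod_topology
        second_countable_discrete_topology)
next
  fix p assume "p \<in> topspace (prod_topology X (discrete_topology K))"
  then obtain x k where p: "p = (x, k)" "x \<in> topspace X" "k \<in> K" by auto
  then obtain U and W :: "(real ^ 2) set" where U: "openin X U" "x \<in> U" "open W"
    "subtopology X U homeomorphic_space top_of_set W"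
    using X unfolding topological_2_manifold_def by blast
  have "subtopology X U homeomorphic_space
      prod_topology (subtopology X U) (subtopology (discrete_topology K) {k})"
    using p by (intro homeomorphic_space_prod_topology_sing1) simp
  then have "subtopology (prod_topology X (discrete_topology K)) (U \<times> {k}) homeomorphic_space top_of_set W"
    unfolding subtopology_Times using U(4) homeomorphic_space_sym homeomorphic_space_trans by blast
  then show "\<exists>U. \<exists>W :: (real ^ 2) set. openin (prod_topology X (discrete_topology K)) U \<and> p \<in> U \<and> open W \<and>
      subtopology (prod_topology X (discrete_topology K)) U homeomorphic_space top_of_set W"
    using U p by (intro exI[of _ "U \<times> {k}"] exI[of _ W]) (auto simp: openin_prod_Times_iff)
qed

section \<open>Charts of the circle and of the torus\<close>

text \<open>The chart is the orthogonal projection of the half circle centred at \<open>z\<^sub>0\<close> to the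
  tangent line at \<open>z\<^sub>0\<close>.\<close>

lemma half_circle_homeomorphic_interval:
  fixes z\<^sub>0 :: complex
  assumes "z\<^sub>0 \<in> sphere 0 1"
  shows "{z \<in> sphere 0 1. 0 < Re (z * cnj z\<^sub>0)} homeomorphic {-1<..<1::real}"
proof -
  have z0: "z\<^sub>0 * cnj z\<^sub>0 = 1" "norm z\<^sub>0 = 1"
    using assms by (auto simp: complex_norm_square[symmetric])
  \<comment> \<open>Multiplication by \<open>cnj z\<^sub>0\<close> rotates the arc to the right half
    of the unit circle, where the chart is the imaginary part; \<open>g\<close> lifts
    \<open>s\<close> back to the arc and undoes the rotation.\<close>
  define g where "g s = z\<^sub>0 * (of_real (sqrt (1 - s\<^sup>2)) + \<i> * of_real s)" for s :: real
  have g_cnj: "g s * cnj z\<^sub>0 = of_real (sqrt (1 - s\<^sup>2)) + \<i> * of_real s" for s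
    using z0(1) by (simp add: g_def mult.assoc mult.left_commute mult.commute)
  have sq: "s\<^sup>2 < 1" if "-1 < s" "s < 1" for s :: real
    using that by (simp add: abs_square_less_1)
  show ?thesis
  proof (rule homeomorphicI[where f = "\<lambda>z. Im (z * cnj z\<^sub>0)" and g = g])
    have *: "(Re (z * cnj z\<^sub>0))\<^sup>2 + (Im (z * cnj z\<^sub>0))\<^sup>2 = 1" if "norm z = 1" for z
    proof -
      have "norm (z * cnj z\<^sub>0) = 1" using that z0 by (simp add: norm_mult)
      then show ?thesis by (simp only: cmod_power2[symmetric]) simp
    qed
    have less_1: "\<bar>Im (z * cnj z\<^sub>0)\<bar> < 1" if "norm z = 1" "0 < Re (z * cnj z\<^sub>0)" for z
      using *[OF that(1)] that(2) by (subst abs_square_less_1[symmetric]) (smt (verit) zero_less_power2)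
    have 1: "(\<lambda>z. Im (z * cnj z\<^sub>0)) ` {z \<in> sphere 0 1. 0 < Re (z * cnj z\<^sub>0)} \<subseteq> {-1<..<1}"
    proof (intro image_subsetI)
      fix z assume "z \<in> {z \<in> sphere 0 1. 0 < Re (z * cnj z\<^sub>0)}"
      then have "norm z = 1" "0 < Re (z * cnj z\<^sub>0)" by simp_all
      then have "\<bar>Im (z * cnj z\<^sub>0)\<bar> < 1" by (rule less_1)
      then show "Im (z * cnj z\<^sub>0) \<in> {-1<..<1}"
        unfolding greaterThanLessThan_iff by linarith
    qed
    have 2: "g ` {-1<..<1} \<subseteq> {z \<in> sphere 0 1. 0 < Re (z * cnj z\<^sub>0)}"
    proof clarify
      fix s :: real assume s: "s \<in> {-1<..<1}"
      have "norm (of_real (sqrt (1 - s\<^sup>2)) + \<i> * of_real s) = 1"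
        using sq[of s] s by (simp add: cmod_def)
      then have "norm (g s) = 1" unfolding g_def norm_mult using z0 by simp
      then show "g s \<in> sphere 0 1 \<and> 0 < Re (g s * cnj z\<^sub>0)"
        unfolding g_cnj using sq[of s] s by simp
    qed
    show gf: "g (Im (z * cnj z\<^sub>0)) = z" if "z \<in> {z \<in> sphere 0 1. 0 < Re (z * cnj z\<^sub>0)}" for z
    proof -
      have "1 - (Im (z * cnj z\<^sub>0))\<^sup>2 = (Re (z * cnj z\<^sub>0))\<^sup>2" using *[of z] that by simp
      \<comment> \<open>The positive real part on the arc selects the positive root.\<close>
      then have "sqrt (1 - (Im (z * cnj z\<^sub>0))\<^sup>2) = Re (z * cnj z\<^sub>0)" using that by simp
      then have "g (Im (z * cnj z\<^sub>0)) = z\<^sub>0 * (z * cnj z\<^sub>0)"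
        unfolding g_def by (metis complex_eq)
      then show ?thesis using z0(1) by (simp add: mult.assoc mult.left_commute mult.commute)
    qed
    show fg: "Im (g s * cnj z\<^sub>0) = s" if "s \<in> {-1<..<1}" for s
      unfolding g_cnj by simp
    show "(\<lambda>z. Im (z * cnj z\<^sub>0)) ` {z \<in> sphere 0 1. 0 < Re (z * cnj z\<^sub>0)} = {-1<..<1}"
      using 1 2 fg by (auto simp: image_subset_iff intro!: rev_image_eqI)
    show "g ` {-1<..<1} = {z \<in> sphere 0 1. 0 < Re (z * cnj z\<^sub>0)}"
    proof (intro equalityI 2 subsetI)
      fix z assume "z \<in> {z \<in> sphere 0 1. 0 < Re (z * cnj z\<^sub>0)}"
      then show "z \<in> g ` {-1<..<1}" using gf 1 by (metis (no_types, lifting) image_eqI image_subset_iff)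
    qed
  qed (auto simp: g_def intro!: continuous_intros)
qed

text \<open>Products of circle charts land in \<open>real \<times> real\<close>, whereas
  \<open>topological_2_manifold\<close> asks for open subsets of \<open>real ^ 2\<close>.\<close>

lemma open_square_homeomorphic:
  "({-1<..<1} \<times> {-1<..<1} :: (real \<times> real) set) homeomorphic
    {v :: real ^ 2. v $ 1 \<in> {-1<..<1} \<and> v $ 2 \<in> {-1<..<1}}"
proof (rule homeomorphicI)
  let ?f = "\<lambda>p :: real \<times> real. (\<chi> i. if i = 1 then fst p else snd p) :: real ^ 2"
  let ?g = "\<lambda>v :: real ^ 2. (v $ 1, v $ 2)"
  have f: "?f (?g v) = v" for v by (simp add: vec_eq_iff forall_2)
  then show "?f ` ({-1<..<1} \<times> {-1<..<1}) = {v. v $ 1 \<in> {-1<..<1} \<and> v $ 2 \<in> {-1<..<1}}"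
    by (force intro: rev_image_eqI[of "(_ $ 1, _ $ 2)"])
  show "?g ` {v. v $ 1 \<in> {-1<..<1} \<and> v $ 2 \<in> {-1<..<1}} = {-1<..<1} \<times> {-1<..<1}"
  proof (intro equalityI subsetI)
    fix p :: "real \<times> real" assume "p \<in> {-1<..<1} \<times> {-1<..<1}"
    then show "p \<in> ?g ` {v. v $ 1 \<in> {-1<..<1} \<and> v $ 2 \<in> {-1<..<1}}"
      by (intro rev_image_eqI[of "?f p"]) auto
  qed auto
  have "continuous_on S (\<lambda>p :: real \<times> real. if i = 1 then fst p else snd p)" for S and i :: 2
    by (cases "i = 1") (auto intro: continuous_intros)
  then show "continuous_on ({-1<..<1} \<times> {-1<..<1}) ?f"
    by (intro continuous_on_vec_lambda)
qed (auto simp: vec_eq_iff forall_2 intro!: continuous_intros)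

text \<open>The chart at \<open>(z, w)\<close> is the product of the half circle charts centred at
  \<open>z\<close> and at \<open>w\<close>.\<close>

lemma topological_2_manifold_torus: "topological_2_manifold torus_topology"
  unfolding topological_2_manifold_def
proof (intro conjI ballI)
  show "Hausdorff_space torus_topology"
    using tychonoff_torus_topology by (simp add: tychonoff_space_def)
  show "second_countable torus_topology"
    by (simp add: torus_topology_eq second_countable_subtopology second_countable_euclidean)
next
  let ?W = "{v :: real ^ 2. v $ 1 \<in> {-1<..<1} \<and> v $ 2 \<in> {-1<..<1}}"
  let ?U = "\<lambda>z\<^sub>0 :: complex. {z \<in> sphere 0 1. 0 < Re (z * cnj z\<^sub>0)}"
  fix p assume "p \<in> topspace torus_topology"
  then obtain z w where p: "p = (z, w)" "z \<in> sphere 0 1" "w \<in> sphere 0 1"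
    by (auto simp: torus_topology_eq carrier_torus)
  have openin_U: "openin (top_of_set (sphere 0 1)) (?U z\<^sub>0)" for z\<^sub>0
  proof -
    have "open {z. 0 < Re (z * cnj z\<^sub>0)}" by (intro open_Collect_less continuous_intros)
    moreover have "?U z\<^sub>0 = sphere 0 1 \<inter> {z. 0 < Re (z * cnj z\<^sub>0)}" by auto
    ultimately show ?thesis by (metis openin_open_Int)
  qed
  have mem_U: "z\<^sub>0 \<in> ?U z\<^sub>0" if "z\<^sub>0 \<in> sphere 0 1" for z\<^sub>0
  proof -
    have "z\<^sub>0 * cnj z\<^sub>0 = 1" using that by (auto simp: complex_norm_square[symmetric])
    then have "Re (z\<^sub>0 * cnj z\<^sub>0) = 1" by simp
    with that show ?thesis by (simp only: mem_Collect_eq) simp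
  qed
  have "top_of_set (?U z \<times> ?U w) homeomorphic_space top_of_set ({-1<..<1::real} \<times> {-1<..<1::real})"
    using homeomorphic_space_prod_topology[OF
        half_circle_homeomorphic_interval[OF p(2), THEN homeomorphic_imp_homeomorphic_space]
        half_circle_homeomorphic_interval[OF p(3), THEN homeomorphic_imp_homeomorphic_space]]
    by (simp only: prod_topology_subtopology_eu)
  also have "\<dots> homeomorphic_space top_of_set ?W"
    by (rule homeomorphic_imp_homeomorphic_space[OF open_square_homeomorphic])
  also have "top_of_set (?U z \<times> ?U w) = subtopology torus_topology (?U z \<times> ?U w)"
  proof -
    have "carrier torus \<inter> ?U z \<times> ?U w = ?U z \<times> ?U w" by (auto simp: carrier_torus)
    then show ?thesis by (simp only: torus_topology_eq subtopology_subtopology)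
  qed
  finally have "subtopology torus_topology (?U z \<times> ?U w) homeomorphic_space top_of_set ?W" .
  moreover have "openin torus_topology (?U z \<times> ?U w)"
    unfolding torus_topology_def openin_prod_Times_iff using openin_U by blast
  moreover have "open ?W"
    by (auto simp: Collect_conj_eq intro!: open_Int open_Collect_less continuous_intros)
  ultimately show "\<exists>U. \<exists>W :: (real ^ 2) set. openin torus_topology U \<and> p \<in> U \<and> open W \<and>
      subtopology torus_topology U homeomorphic_space top_of_set W"
    using mem_U[OF p(2)] mem_U[OF p(3)] p(1) by blast
qed

section \<open>Non-representability\<close>

lemma shear_quotient_not_rosenthal_representable:
  "\<not> rosenthal_representable_on TYPE('v::banach) shear_group torus_semidirect_topology shear_quotient
      (\<lambda>g C. g <#\<^bsub>shear_group\<^esub> C)"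
proof
  assume "rosenthal_representable_on TYPE('v) shear_group torus_semidirect_topology shear_quotient
      (\<lambda>g C. g <#\<^bsub>shear_group\<^esub> C)"
  then obtain h :: "(complex \<times> complex) \<times> int \<Rightarrow> 'v \<Rightarrow>\<^sub>L 'v" and \<alpha>
    where no_l1: "\<not> contains_l1 TYPE('v)"
      and hom: "h \<in> hom shear_group isometry_group"
      and bdd: "bounded (\<alpha> ` topspace shear_quotient)"
      and cont: "continuous_map shear_quotient weak_star_topology \<alpha>"
      and equiv: "\<And>g C. g \<in> carrier shear_group \<Longrightarrow> C \<in> topspace shear_quotient \<Longrightarrow>
        \<alpha> (g <#\<^bsub>shear_group\<^esub> C) = dual_action (h g) (\<alpha> C)"
      and emb: "embedding_map shear_quotient weak_star_topology \<alpha>"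
    unfolding rosenthal_representable_on_def rosenthal_space_def is_proper_representation_def
      is_representation_def by blast
  define f where "f v x = blinfun_apply (\<alpha> (torus_coset x)) v" for v x
  obtain M where M: "\<And>x. x \<in> carrier torus \<Longrightarrow> norm (\<alpha> (torus_coset x)) \<le> M"
    using bdd by (auto simp: bounded_iff topspace_shear_quotient)
  have f_cont: "continuous_on (carrier torus) (f v)" for v
  proof -
    have "continuous_map torus_topology euclidean ((\<lambda>u. blinfun_apply u v) \<circ> \<alpha> \<circ> torus_coset)"
      using homeomorphic_imp_continuous_map[OF homeomorphic_map_torus_coset]
        continuous_map_compose[OF cont[unfolded weak_star_topology_def]
          strong_operator_topology_continuous_evaluation]
      by (rule continuous_map_compose)
    then show ?thesis
      by (simp add: torus_topology_eq f_def[abs_def] comp_def)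
  qed
  define w where "w v k = blinfun_apply (inv\<^bsub>isometry_group\<^esub> (h (\<one>\<^bsub>torus\<^esub>, k))) v" for v k
  have norm_w: "norm (w v k) = norm v" for v k
  proof -
    have "h (\<one>\<^bsub>torus\<^esub>, k) \<in> carrier isometry_group"
      using hom by (auto simp: hom_def carrier_shear_group one_torus carrier_torus)
    then show ?thesis
      unfolding w_def by (intro isometry_groupD group.inv_closed group_isometry_group)
  qed
  \<comment> \<open>Equivariance under \<open>(1, k)\<close> moves the shear from the point of the
    torus to the vector, at no cost in norm.\<close>
  have f_shear: "f v (torus_shear k x) = f (w v k) x" if "x \<in> carrier torus" for v k x
  proof -
    interpret T: group torus by (rule group_torus)
    have "\<alpha> ((\<one>\<^bsub>torus\<^esub>, k) <#\<^bsub>shear_group\<^esub> torus_coset x)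
        = dual_action (h (\<one>\<^bsub>torus\<^esub>, k)) (\<alpha> (torus_coset x))"
      using that by (intro equiv) (auto simp: carrier_shear_group topspace_shear_quotient)
    then show ?thesis
      using that by (simp add: coset_torus_coset torus_shear_closed dual_action_def f_def w_def)
  qed
  \<comment> \<open>Both points lie over \<open>1\<close>, and for \<open>z\<close> near
    \<open>1\<close> the point \<open>(z, z ^ k)\<close> can be near either of them.\<close>
  have "\<alpha> (torus_coset (1, 1)) \<noteq> \<alpha> (torus_coset (1, -1))"
  proof -
    have "inj_on \<alpha> (topspace shear_quotient)"
      using emb unfolding embedding_map_def by (rule homeomorphic_imp_injective_map)
    moreover have "torus_coset (1, 1) \<in> topspace shear_quotient"
      "torus_coset (1, -1) \<in> topspace shear_quotient"
      by (auto simp: topspace_shear_quotient carrier_torus)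
    ultimately show ?thesis
      by (simp add: inj_on_eq_iff torus_coset_eq_iff)
  qed
  then obtain v' where "f v' (1, 1) \<noteq> f v' (1, -1)"
    unfolding f_def using blinfun_eqI by blast
  \<comment> \<open>A change of sign of the vector orients the inequality.\<close>
  then have "f v' (1, 1) < f v' (1, -1) \<or> f (- v') (1, 1) < f (- v') (1, -1)"
    by (auto simp: f_def blinfun.minus_right)
  then obtain v where "f v (1, 1) < f v (1, -1)" by blast
  then obtain a b where ab: "f v (1, 1) < a" "a < b" "b < f v (1, -1)"
    by (metis dense)
  \<comment> \<open>In angle coordinates the two strict inequalities persist on a ball around the
    origin, for first coordinate near \<open>1\<close> and second coordinate near \<open>1\<close>
    or near \<open>-1\<close>.\<close>
  have "open {p. f v (cis (fst p), cis (snd p)) < a \<and> b < f v (cis (fst p), - cis (snd p))}"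
    unfolding Collect_conj_eq
    by (intro open_Int open_Collect_less continuous_on_const continuous_on_compose2[OF f_cont[of v]])
       (auto simp: carrier_torus intro!: continuous_intros)
  moreover have "(0, 0) \<in> {p. f v (cis (fst p), cis (snd p)) < a \<and> b < f v (cis (fst p), - cis (snd p))}"
    using ab by simp
  ultimately obtain e where e: "e > 0"
    "ball (0, 0) e \<subseteq> {p. f v (cis (fst p), cis (snd p)) < a \<and> b < f v (cis (fst p), - cis (snd p))}"
    by (rule openE)
  \<comment> \<open>Two angles of size at most \<open>\<delta>\<close> form a pair of norm at most
    \<open>2 * \<delta>\<close>, which is less than \<open>e\<close>.\<close>
  define \<delta> where "\<delta> = e / 3"
  have "\<delta> > 0" using e by (simp add: \<delta>_def)
  have near: "f v (cis \<theta>, cis t) < a \<and> b < f v (cis \<theta>, - cis t)"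
    if "\<theta> \<in> {0..\<delta>}" "t \<in> {0..\<delta>}" for \<theta> t
  proof -
    have "norm (\<theta>, t) < e"
      using that norm_Pair_le[of \<theta> t] e(1) by (auto simp: \<delta>_def)
    then have "(\<theta>, t) \<in> ball (0, 0) e"
      unfolding zero_prod_def[symmetric] mem_ball_0 .
    with e(2) show ?thesis by auto
  qed
  \<comment> \<open>Doubling \<open>N\<^sub>0\<close> gives an even base and keeps the lower bound
    on it.\<close>
  obtain N\<^sub>0 where "(pi + \<delta>) / \<delta> \<le> real N\<^sub>0" using real_arch_simple by blast
  then have "pi + \<delta> \<le> real N\<^sub>0 * \<delta>"
    using \<open>\<delta> > 0\<close> by (simp add: pos_divide_le_eq)
  moreover have "0 \<le> real N\<^sub>0 * \<delta>" using \<open>\<delta> > 0\<close> by simp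
  ultimately have N: "even (2 * N\<^sub>0)" "pi + \<delta> \<le> real (2 * N\<^sub>0) * \<delta>" by simp_all
  have "contains_l1 TYPE('v)"
  proof (rule independent_imp_contains_l1)
    \<comment> \<open>The sequence consists of the translates of \<open>v\<close> along the powers
      of the base, starting with exponent \<open>1\<close> as in
      \<open>cis_powers_prescribed_signs\<close>.\<close>
    show "norm (w v (int ((2 * N\<^sub>0) ^ Suc n))) \<le> norm v" for n by (simp add: norm_w)
    show "a < b" by fact
    fix A :: "nat set" and K
    obtain \<theta> where \<theta>: "\<theta> \<in> {0..\<delta>}" and signs: "\<And>j. j < K \<Longrightarrow>
        \<exists>t\<in>{0..\<delta>}. cis \<theta> ^ ((2 * N\<^sub>0) ^ Suc j) = (if j \<in> A then -1 else 1) * cis t"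
      using cis_powers_prescribed_signs[OF N, of K A] \<open>\<delta> > 0\<close> by auto
    \<comment> \<open>The shear by \<open>n\<close> sends \<open>(cis \<theta>, 1)\<close> to
      \<open>(cis \<theta>, cis \<theta> ^ n)\<close>, so one functional evaluates
      \<open>f v\<close> at all these points.\<close>
    have pairing: "blinfun_apply (\<alpha> (torus_coset (cis \<theta>, 1))) (w v (int n)) = f v (cis \<theta>, cis \<theta> ^ n)" for n
      using f_shear[of "(cis \<theta>, 1)" v "int n"]
      by (simp add: carrier_torus torus_shear_apply f_def)
    show "\<exists>u. norm u \<le> M \<and> (\<forall>j<K.
        (j \<in> A \<longrightarrow> b \<le> blinfun_apply u (w v (int ((2 * N\<^sub>0) ^ Suc j)))) \<and>
        (j \<notin> A \<longrightarrow> blinfun_apply u (w v (int ((2 * N\<^sub>0) ^ Suc j))) \<le> a))"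
    \<comment> \<open>For \<open>j \<in> A\<close> the power of \<open>cis \<theta>\<close> lies
      near \<open>-1\<close>, which gives a value above \<open>b\<close>; otherwise it lies near
      \<open>1\<close>, which gives a value below \<open>a\<close>.\<close>
    proof (intro exI[of _ "\<alpha> (torus_coset (cis \<theta>, 1))"] conjI allI impI)
      show "norm (\<alpha> (torus_coset (cis \<theta>, 1))) \<le> M" by (rule M) (simp add: carrier_torus)
    next
      fix j assume "j < K" "j \<in> A"
      with signs near[OF \<theta>]
      show "b \<le> blinfun_apply (\<alpha> (torus_coset (cis \<theta>, 1))) (w v (int ((2 * N\<^sub>0) ^ Suc j)))"
        unfolding pairing by fastforce
    next
      fix j assume "j < K" "j \<notin> A"
      with signs near[OF \<theta>]
      show "blinfun_apply (\<alpha> (torus_coset (cis \<theta>, 1))) (w v (int ((2 * N\<^sub>0) ^ Suc j))) \<le> a"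
        unfolding pairing by fastforce
    qed
  qed
  with no_l1 show False ..
qed

text \<open>The explicit formula, together with extensionality of automorphisms, pins down
  \<open>\<sigma>\<close> independently of the type \<open>'v\<close>, so that a single automorphism
  serves all Banach spaces.\<close>

theorem corollary4p1:
  shows "\<exists>\<sigma>.
    topological_group_automorphism torus torus_topology \<sigma> \<and>
    (\<forall>z\<in>sphere 0 1. \<forall>w\<in>sphere 0 1. \<sigma> (z, w) = (z, z * w)) \<and>
    (let G = torus_semidirect \<sigma>;
         T = torus_semidirect_topology;
         H = integer_subgroup;
         X = coset_topology G T H;
         act = (\<lambda>g C. g <#\<^bsub>G\<^esub> C)
     in topological_group G T \<and> topological_2_manifold T \<and>
        subgroup H G \<and> subtopology T H = discrete_topology H \<and>
        compact_space X \<and> topological_2_manifold X \<and> g_space G T X act \<and>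
        \<not> rosenthal_representable_on TYPE('v::banach) G T X act)"
proof -
  have "topological_2_manifold torus_semidirect_topology"
    unfolding torus_semidirect_topology_def
    by (intro topological_2_manifold_Times_discrete topological_2_manifold_torus) simp
  moreover have "topological_2_manifold shear_quotient"
    using homeomorphic_map_imp_homeomorphic_space[OF homeomorphic_map_torus_coset]
      topological_2_manifold_torus
    by (rule homeomorphic_topological_2_manifold)
  ultimately show ?thesis
    unfolding Let_def
    by (intro exI[of _ "torus_shear 1"] conjI ballI topological_group_automorphism_torus_shear
        topological_group_shear_group[unfolded shear_group_def]
        subgroup_integer_subgroup[unfolded shear_group_def] subtopology_integer_subgroup
        compact_space_shear_quotient[unfolded shear_group_def]
        g_space_shear_quotient[unfolded shear_group_def]
        shear_quotient_not_rosenthal_representable[unfolded shear_group_def])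
      (simp_all add: torus_shear_apply flip: shear_group_def)
qed

end
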